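(* Let $a,b$ be positive integers with $a<b$, let $n\ge 0$ be an integer, and let $G=\mathcal{F}(n;a,b)$. If $n\le a$, then $G=*n$. Otherwise (i.e. if $n>a$), the canonical form of $G$ is $$\{\mathcal{F}(n-1;a,b),\ \mathcal{F}(n-2;a,b),\ \dots,\ \mathcal{F}(n-a;a,b)\ \mid\ 0\}.$$
   Context: Games are short two-player combinatorial games (players Left and Right) under normal play: a player unable to move on their turn loses. Full Support (FS): for positive integers $a,b$ and an integer $n\ge 0$, $\mathcal{F}(n;a,b)$ is the game played on one heap of $n$ pebbles in which Left, on her turn, may remove any number $i\in\{1,\dots,a\}$ of pebbles with $i\le n$, and Right, on his turn, may remove any number $j\in\{1,\dots,b\}$ with $j\le n$. Thus the Left options are $\mathcal{F}(n-i;a,b)$ and the Right options are $\mathcal{F}(n-j;a,b)$. The game $0=\{\varnothing\mid\varnothing\}$ has no options, and $*n$ is the nimber (Nim heap) of size $n$, with $*0=0$, whose options for both players are $*0,*1,\dots,*(n-1)$. Equality of games is $G=H$ iff $G-H$ is a second-player win. The canonical form of a game is the unique game equal to it in which no position has a dominated or reversible option. In the displayed form, each listed Left option is understood to be itself written in canonical form. The assertion about the form is that no listed Left option is dominated or reversible, and the unique Right option is $0$. *)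

theory Defs
  imports Main "HOL-Library.FSet"
begin

text \<open>
  A short game is represented by its form: a finite set of Left options and a finite set of
  Right options. HOL equality on this type is identity of forms; equality of games is the
  relation \<open>game_eq\<close> below.
\<close>

datatype game = Game (left_opts: "game fset") (right_opts: "game fset")

lemma size_left_option: "L |\<in>| left_opts G \<Longrightarrow> size L < size G"
  using member_le_sum[of L "fset (left_opts G)" "\<lambda>x. Suc (size x)"]
  by (cases G) simp

lemma size_right_option: "R |\<in>| right_opts G \<Longrightarrow> size R < size G"
  using member_le_sum[of R "fset (right_opts G)" "\<lambda>x. Suc (size x)"]
  by (cases G) simp

inductive position_of :: "game \<Rightarrow> game \<Rightarrow> bool" where
  self: "position_of G G"
| left: "position_of H G \<Longrightarrow> L |\<in>| left_opts H \<Longrightarrow> position_of L G"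
| right: "position_of H G \<Longrightarrow> R |\<in>| right_opts H \<Longrightarrow> position_of R G"

definition zero_game :: game where
  "zero_game = Game {||} {||}"

primrec game_neg :: "game \<Rightarrow> game" where
  "game_neg (Game Ls Rs) = Game (game_neg |`| Rs) (game_neg |`| Ls)"

context
  notes fimage_cong [fundef_cong]
begin

function game_add :: "game \<Rightarrow> game \<Rightarrow> game" where
  "game_add G H =
     Game ((\<lambda>L. game_add L H) |`| left_opts G |\<union>| (\<lambda>L. game_add G L) |`| left_opts H)
          ((\<lambda>R. game_add R H) |`| right_opts G |\<union>| (\<lambda>R. game_add G R) |`| right_opts H)"
  by pat_completeness auto
termination
  by (relation "measure (\<lambda>(G, H). size G + size H)")
    (auto dest: size_left_option size_right_option)

end

declare game_add.simps [simp del]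

definition game_diff :: "game \<Rightarrow> game \<Rightarrow> game" where
  "game_diff G H = game_add G (game_neg H)"

text \<open>
  Normal play: a player who is to move and has no option loses. In each of the two functions
  the named player makes the first move.
\<close>

function left_wins_first :: "game \<Rightarrow> bool" and right_wins_first :: "game \<Rightarrow> bool" where
  "left_wins_first G \<longleftrightarrow> fBex (left_opts G) (\<lambda>L. \<not> right_wins_first L)"
| "right_wins_first G \<longleftrightarrow> fBex (right_opts G) (\<lambda>R. \<not> left_wins_first R)"
  by pat_completeness auto
termination
  by (relation "measure (case_sum size size)") (auto dest: size_left_option size_right_option)

declare left_wins_first.simps [simp del] right_wins_first.simps [simp del]

definition second_player_win :: "game \<Rightarrow> bool" where
  "second_player_win G \<longleftrightarrow> \<not> left_wins_first G \<and> \<not> right_wins_first G"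

definition game_eq :: "game \<Rightarrow> game \<Rightarrow> bool" where
  "game_eq G H \<longleftrightarrow> second_player_win (game_diff G H)"

text \<open>\<open>G \<ge> H\<close> means that Left, moving second, wins \<open>G - H\<close>.\<close>

definition game_ge :: "game \<Rightarrow> game \<Rightarrow> bool" where
  "game_ge G H \<longleftrightarrow> \<not> right_wins_first (game_diff G H)"

definition left_dominated :: "game \<Rightarrow> game \<Rightarrow> bool" where
  "left_dominated G L \<longleftrightarrow> L |\<in>| left_opts G \<and>
     (\<exists>L'. L' |\<in>| left_opts G \<and> L' \<noteq> L \<and> game_ge L' L)"

definition right_dominated :: "game \<Rightarrow> game \<Rightarrow> bool" where
  "right_dominated G R \<longleftrightarrow> R |\<in>| right_opts G \<and>
     (\<exists>R'. R' |\<in>| right_opts G \<and> R' \<noteq> R \<and> game_ge R R')"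

definition left_reversible :: "game \<Rightarrow> game \<Rightarrow> bool" where
  "left_reversible G L \<longleftrightarrow> L |\<in>| left_opts G \<and>
     (\<exists>LR. LR |\<in>| right_opts L \<and> game_ge G LR)"

definition right_reversible :: "game \<Rightarrow> game \<Rightarrow> bool" where
  "right_reversible G R \<longleftrightarrow> R |\<in>| right_opts G \<and>
     (\<exists>RL. RL |\<in>| left_opts R \<and> game_ge RL G)"

definition canonical :: "game \<Rightarrow> bool" where
  "canonical K \<longleftrightarrow> (\<forall>P. position_of P K \<longrightarrow>
     (\<forall>X. \<not> left_dominated P X \<and> \<not> right_dominated P X \<and>
          \<not> left_reversible P X \<and> \<not> right_reversible P X))"

definition is_canonical_form_of :: "game \<Rightarrow> game \<Rightarrow> bool" where
  "is_canonical_form_of K G \<longleftrightarrow> game_eq K G \<and> canonical K"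

text \<open>
  Every short game has exactly one canonical form (unique even as a form, since a form is a pair
  of sets), so the description below is proper.
\<close>

definition canonical_form :: "game \<Rightarrow> game" where
  "canonical_form G = (THE K. is_canonical_form_of K G)"

context
  notes fimage_cong [fundef_cong]
begin

function nimber :: "nat \<Rightarrow> game" where
  "nimber n = Game (nimber |`| fset_of_list [0..<n]) (nimber |`| fset_of_list [0..<n])"
  by pat_completeness auto
termination
  by (relation "measure id") (auto simp: fset_of_list_elem)

text \<open>The lists of removable amounts run from \<open>1\<close> to \<open>min a n\<close> and \<open>min b n\<close>.\<close>

function full_support :: "nat \<Rightarrow> nat \<Rightarrow> nat \<Rightarrow> game" where
  "full_support n a b =
     Game ((\<lambda>i. full_support (n - i) a b) |`| fset_of_list [1..<Suc (min a n)])
          ((\<lambda>j. full_support (n - j) a b) |`| fset_of_list [1..<Suc (min b n)])"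
  by pat_completeness auto
termination
  by (relation "measure (\<lambda>(n, a, b). n)") (auto simp: fset_of_list_elem)

end

declare nimber.simps [simp del] full_support.simps [simp del]

end

theory Submission
  imports Defs
begin

text \<open>
  Write \<open>G k\<close> for the heap of size \<open>k\<close>, with \<open>a < b\<close>. Everything rests on how heaps of different
  sizes compare. For \<open>k < m\<close>, never \<open>G m \<ge> G k\<close>: in \<open>G m - G k\<close> Right, moving first, takes the
  larger heap down to size \<open>k\<close> if \<open>m - k \<le> b\<close>, leaving a game equal to zero, and otherwise takes
  just one pebble from it, leaving it still more than \<open>a\<close> pebbles ahead. Such a lead
  is decisive: if \<open>k + a < m\<close> then \<open>G k \<ge> G m\<close>, because after any single move of Right in
  \<open>G k - G m\<close> the second heap is still strictly larger, and by the first claim Left, now to move, wins. The two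
  claims feed each other in an induction on \<open>k + m\<close>
  (\<open>full_support_compare\<close>). Different heaps whose sizes differ by at most \<open>a\<close> are confused,
  since there Left too can move the larger heap to the smaller one.

  The theorem follows. For \<open>n \<le> a\<close> both players can move to every smaller heap, so \<open>G n\<close> is the
  nimber \<open>n\<close>, even as a form. For \<open>n > a\<close>, all Left options \<open>G (n - i)\<close> are pairwise confused, so
  none is dominated, and none is reversible, as \<open>G n \<ge> G k\<close> fails for all smaller \<open>k\<close>. Replacing
  all Right options by \<open>0\<close> preserves the value: \<open>0\<close> can be offered to Right because
  \<open>G n \<ge> 0\<close> fails, and a move of Right to any \<open>G k\<close> gives him nothing beyond it, because Left
  replies by removing as many pebbles as she can, reaching a heap that is at least \<open>G n\<close>
  (\<open>not_ge_smaller_heap\<close>). That the form so obtained is \<^emph>\<open>the\<close> canonical form is the classical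
  uniqueness theorem (\<open>canonical_unique\<close>), which rests on the order being transitive.
\<close>

section \<open>The order on games\<close>

lemma left_opts_neg: "left_opts (game_neg G) = game_neg |`| right_opts G"
  by (cases G) simp

lemma right_opts_neg: "right_opts (game_neg G) = game_neg |`| left_opts G"
  by (cases G) simp

lemma left_opts_diff:
  "left_opts (game_diff G H) =
     (\<lambda>L. game_diff L H) |`| left_opts G |\<union>| (\<lambda>R. game_diff G R) |`| right_opts H"
  unfolding game_diff_def
  by (subst game_add.simps) (simp add: left_opts_neg fset.map_comp comp_def)

lemma right_opts_diff:
  "right_opts (game_diff G H) =
     (\<lambda>R. game_diff R H) |`| right_opts G |\<union>| (\<lambda>L. game_diff G L) |`| left_opts H"
  unfolding game_diff_def
  by (subst game_add.simps) (simp add: right_opts_neg fset.map_comp comp_def)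

lemma left_wins_first_diff_iff:
  "left_wins_first (game_diff G H) \<longleftrightarrow>
     (\<exists>L. L |\<in>| left_opts G \<and> \<not> right_wins_first (game_diff L H)) \<or>
     (\<exists>R. R |\<in>| right_opts H \<and> \<not> right_wins_first (game_diff G R))"
  by (subst left_wins_first.simps) (auto simp: left_opts_diff)

lemma right_wins_first_diff_iff:
  "right_wins_first (game_diff G H) \<longleftrightarrow>
     (\<exists>R. R |\<in>| right_opts G \<and> \<not> left_wins_first (game_diff R H)) \<or>
     (\<exists>L. L |\<in>| left_opts H \<and> \<not> left_wins_first (game_diff G L))"
  by (subst right_wins_first.simps) (auto simp: right_opts_diff)

text \<open>
  Exchanging the two games negates the difference and so exchanges the players. This is what
  turns statements about play in a difference into a relation between its two components.
\<close>

lemma left_wins_first_diff_swap: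
  "left_wins_first (game_diff G H) \<longleftrightarrow> right_wins_first (game_diff H G)"
proof (induction "size G + size H" arbitrary: G H rule: less_induct)
  case less
  have "left_wins_first (game_diff H L) \<longleftrightarrow> right_wins_first (game_diff L H)"
    if "L |\<in>| left_opts G" for L
    using less size_left_option[OF that] by (metis add.commute add_less_mono1)
  moreover have "left_wins_first (game_diff R G) \<longleftrightarrow> right_wins_first (game_diff G R)"
    if "R |\<in>| right_opts H" for R
    using less size_right_option[OF that] by (metis add.commute add_less_mono1)
  ultimately show ?case
    unfolding left_wins_first_diff_iff[of G H] right_wins_first_diff_iff[of H G] by blast
qed

text \<open>
  Conway's recursive description of the order, from which all later comparisons are computed.
\<close>

lemma game_ge_iff:
  "game_ge G H \<longleftrightarrow>
     (\<forall>R. R |\<in>| right_opts G \<longrightarrow> \<not> game_ge H R) \<and>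
     (\<forall>L. L |\<in>| left_opts H \<longrightarrow> \<not> game_ge L G)"
  unfolding game_ge_def right_wins_first_diff_iff[of G H]
  by (auto simp: left_wins_first_diff_swap)

lemma game_eq_iff: "game_eq G H \<longleftrightarrow> game_ge G H \<and> game_ge H G"
  unfolding game_eq_def second_player_win_def game_ge_def left_wins_first_diff_swap by auto

lemma game_ge_refl: "game_ge G G"
proof (induction "size G" arbitrary: G rule: less_induct)
  case less
  have "\<not> game_ge G R" if "R |\<in>| right_opts G" for R
    using less[OF size_right_option[OF that]] that game_ge_iff[of G R] by blast
  moreover have "\<not> game_ge L G" if "L |\<in>| left_opts G" for L
    using less[OF size_left_option[OF that]] that game_ge_iff[of L G] by blast
  ultimately show ?case
    by (subst game_ge_iff) blast
qed

lemma game_eq_refl: "game_eq G G"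
  by (simp add: game_eq_iff game_ge_refl)

lemma not_ge_right_option: "R |\<in>| right_opts G \<Longrightarrow> \<not> game_ge G R"
  using game_ge_refl[of R] game_ge_iff[of G R] game_ge_refl[of G] game_ge_iff[of G G] by blast

lemma not_left_option_ge: "L |\<in>| left_opts G \<Longrightarrow> \<not> game_ge L G"
  using game_ge_refl[of G] game_ge_iff[of G G] by blast

lemma game_ge_trans:
  assumes "game_ge G H" and "game_ge H K"
  shows "game_ge G K"
  using assms
proof (induction "size G + size H + size K" arbitrary: G H K rule: less_induct)
  case less
  have "\<not> game_ge K R" if R: "R |\<in>| right_opts G" for R
  proof
    assume "game_ge K R"
    moreover have "size H + size K + size R < size G + size H + size K"
      using size_right_option[OF R] by simp
    ultimately have "game_ge H R"
      using less.hyps less.prems by blast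
    then show False
      using R less.prems(1) game_ge_iff[of G H] by blast
  qed
  moreover have "\<not> game_ge L G" if L: "L |\<in>| left_opts K" for L
  proof
    assume "game_ge L G"
    moreover have "size L + size G + size H < size G + size H + size K"
      using size_left_option[OF L] by simp
    ultimately have "game_ge L H"
      using less.hyps less.prems by blast
    then show False
      using L less.prems(2) game_ge_iff[of H K] by blast
  qed
  ultimately show ?case
    by (subst game_ge_iff) blast
qed

lemma game_ge_cong:
  assumes "game_eq G G'" and "game_eq H H'"
  shows "game_ge G H \<longleftrightarrow> game_ge G' H'"
  using assms game_ge_trans unfolding game_eq_iff by blast


section \<open>Uniqueness of canonical forms\<close>

lemma position_of_trans:
  assumes "position_of P H" and "position_of H G"
  shows "position_of P G"
  using assms by induction (auto intro: position_of.intros)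

lemma canonical_left_option: "canonical G \<Longrightarrow> L |\<in>| left_opts G \<Longrightarrow> canonical L"
  unfolding canonical_def
  by (meson position_of_trans position_of.self position_of.left)

lemma canonical_right_option: "canonical G \<Longrightarrow> R |\<in>| right_opts G \<Longrightarrow> canonical R"
  unfolding canonical_def
  by (meson position_of_trans position_of.self position_of.right)

lemma canonicalI:
  assumes "\<And>X. \<not> left_dominated G X" and "\<And>X. \<not> right_dominated G X"
    and "\<And>X. \<not> left_reversible G X" and "\<And>X. \<not> right_reversible G X"
    and "\<And>L. L |\<in>| left_opts G \<Longrightarrow> canonical L"
    and "\<And>R. R |\<in>| right_opts G \<Longrightarrow> canonical R"
  shows "canonical G"
proof -
  have "P = G \<or> (\<exists>X. (X |\<in>| left_opts G \<or> X |\<in>| right_opts G) \<and> position_of P X)"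
    if "position_of P G" for P
    using that by induction (auto intro: position_of.intros)
  then show ?thesis
    using assms unfolding canonical_def by blast
qed

text \<open>
  Since \<open>H \<ge> G\<close>, the inequality \<open>L \<ge> H\<close> fails for a Left option \<open>L\<close> of \<open>G\<close>. A Right option of \<open>L\<close>
  cannot be the cause, as this would make \<open>L\<close> reversible; so a Left option of \<open>H\<close> is.
\<close>

lemma left_option_matched:
  assumes eq: "game_eq G H" and L: "L |\<in>| left_opts G" and irrev: "\<not> left_reversible G L"
  obtains L' where "L' |\<in>| left_opts H" "game_ge L' L"
proof -
  have "\<not> game_ge L H"
    using eq L game_ge_iff[of H G] unfolding game_eq_iff by blast
  moreover have "\<not> game_ge H R" if "R |\<in>| right_opts L" for R
    using that irrev L eq game_ge_trans unfolding left_reversible_def game_eq_iff by blast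
  ultimately show ?thesis
    using that game_ge_iff[of L H] by blast
qed

lemma right_option_matched:
  assumes eq: "game_eq G H" and R: "R |\<in>| right_opts G" and irrev: "\<not> right_reversible G R"
  obtains R' where "R' |\<in>| right_opts H" "game_ge R R'"
proof -
  have "\<not> game_ge H R"
    using eq R game_ge_iff[of G H] unfolding game_eq_iff by blast
  moreover have "\<not> game_ge L H" if "L |\<in>| left_opts R" for L
    using that irrev R eq game_ge_trans unfolding right_reversible_def game_eq_iff by blast
  ultimately show ?thesis
    using that game_ge_iff[of H R] by blast
qed

text \<open>
  Matching an option into the other game and back again yields an option that is at least as good
  as the original one; without dominated options it is the original one, so the option and its
  match are equal in value, and by induction identical.
\<close>

lemma canonical_unique:
  assumes "canonical G" and "canonical H" and "game_eq G H"
  shows "G = H"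
  using assms
proof (induction "size G + size H" arbitrary: G H rule: less_induct)
  case less
  have half: "left_opts A |\<subseteq>| left_opts B \<and> right_opts A |\<subseteq>| right_opts B"
    if A: "canonical A" and B: "canonical B" and AB: "game_eq A B"
      and size: "size A + size B = size G + size H" for A B
  proof -
    have BA: "game_eq B A"
      using AB by (simp add: game_eq_iff)
    have good: "\<not> left_dominated P X" "\<not> right_dominated P X"
      "\<not> left_reversible P X" "\<not> right_reversible P X" if "P = A \<or> P = B" for P X
      using that A B position_of.self unfolding canonical_def by blast+
    show ?thesis
    proof (intro conjI fsubsetI)
      fix L assume L: "L |\<in>| left_opts A"
      show "L |\<in>| left_opts B"
      proof -
        obtain L' where L': "L' |\<in>| left_opts B" "game_ge L' L"
          using left_option_matched[OF AB L good(3)] by blast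
        obtain L'' where L'': "L'' |\<in>| left_opts A" "game_ge L'' L'"
          using left_option_matched[OF BA L'(1) good(3)] by blast
        have "L'' = L"
          using good(1)[of A L] L L'' L'(2) game_ge_trans unfolding left_dominated_def by blast
        then have "game_eq L L'"
          using L' L'' by (simp add: game_eq_iff)
        moreover have "size L + size L' < size G + size H"
          using size_left_option[OF L] size_left_option[OF L'(1)] size by linarith
        moreover have "canonical L" "canonical L'"
          using canonical_left_option A B L L'(1) by blast+
        ultimately have "L = L'"
          using less.hyps by blast
        with L'(1) show ?thesis
          by simp
      qed
    next
      fix R assume R: "R |\<in>| right_opts A"
      show "R |\<in>| right_opts B"
      proof -
        obtain R' where R': "R' |\<in>| right_opts B" "game_ge R R'"
          using right_option_matched[OF AB R good(4)] by blast
        obtain R'' where R'': "R'' |\<in>| right_opts A" "game_ge R' R''"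
          using right_option_matched[OF BA R'(1) good(4)] by blast
        have "R'' = R"
          using good(2)[of A R] R R'' R'(2) game_ge_trans unfolding right_dominated_def by blast
        then have "game_eq R R'"
          using R' R'' by (simp add: game_eq_iff)
        moreover have "size R + size R' < size G + size H"
          using size_right_option[OF R] size_right_option[OF R'(1)] size by linarith
        moreover have "canonical R" "canonical R'"
          using canonical_right_option A B R R'(1) by blast+
        ultimately have "R = R'"
          using less.hyps by blast
        with R'(1) show ?thesis
          by simp
      qed
    qed
  qed
  have "game_eq H G"
    using less.prems(3) by (simp add: game_eq_iff)
  then show ?case
    using half[of G H] half[of H G] less.prems by (intro game.expand) auto
qed

lemma canonical_form_eqI:
  assumes "is_canonical_form_of K G"
  shows "canonical_form G = K"
  unfolding canonical_form_def
proof (rule the_equality)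
  show "is_canonical_form_of K G"
    by (fact assms)
  show "K' = K" if "is_canonical_form_of K' G" for K'
  proof (rule canonical_unique)
    show "game_eq K' K"
      using that assms game_ge_trans unfolding is_canonical_form_of_def game_eq_iff by blast
  qed (use that assms in \<open>auto simp: is_canonical_form_of_def\<close>)
qed


section \<open>Comparison of Full Support heaps\<close>

text \<open>
  Options are indexed in the definitions by the number of pebbles removed, but comparisons of
  heaps are governed by what is left over.
\<close>

lemma fimage_remove_iff:
  "X |\<in>| (\<lambda>i. f (n - i)) |`| fset_of_list [1..<Suc (min c n)] \<longleftrightarrow>
     (\<exists>k. k < n \<and> n \<le> k + c \<and> X = f k)" (is "?l \<longleftrightarrow> ?r")
proof
  assume ?l
  then obtain i where "i |\<in>| fset_of_list [1..<Suc (min c n)]" and X: "X = f (n - i)"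
    by blast
  then have "1 \<le> i" "i \<le> c" "i \<le> n"
    by (auto simp: fset_of_list_elem simp del: upt_Suc)
  then show ?r
    using X by (intro exI[of _ "n - i"]) auto
next
  assume ?r
  then obtain k where k: "k < n" "n \<le> k + c" "X = f k"
    by blast
  then have "X = f (n - (n - k))" "n - k |\<in>| fset_of_list [1..<Suc (min c n)]"
    by (auto simp: fset_of_list_elem)
  then show ?l
    by (rule fimage_eqI)
qed

lemma left_opts_full_support:
  "X |\<in>| left_opts (full_support n a b) \<longleftrightarrow> (\<exists>k. k < n \<and> n \<le> k + a \<and> X = full_support k a b)"
  by (subst full_support.simps)
    (simp only: game.sel fimage_remove_iff[of X "\<lambda>k. full_support k a b" n a])

lemma right_opts_full_support:
  "X |\<in>| right_opts (full_support n a b) \<longleftrightarrow> (\<exists>k. k < n \<and> n \<le> k + b \<and> X = full_support k a b)"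
  by (subst full_support.simps)
    (simp only: game.sel fimage_remove_iff[of X "\<lambda>k. full_support k a b" n b])

lemma full_support_0: "full_support 0 a b = zero_game"
  by (subst full_support.simps) (simp add: zero_game_def)

lemma full_support_eq_nimber:
  assumes "n \<le> a" and "n \<le> b"
  shows "full_support n a b = nimber n"
  using assms
proof (induction n rule: less_induct)
  case (less n)
  have opts: "X |\<in>| left_opts (nimber n) \<longleftrightarrow> (\<exists>k<n. X = nimber k)"
    "X |\<in>| right_opts (nimber n) \<longleftrightarrow> (\<exists>k<n. X = nimber k)" for X
    by (subst (1) nimber.simps, force simp: fset_of_list_elem)+
  have IH: "full_support k a b = nimber k" if "k < n" for k
    using less that by simp
  have small: "n \<le> k + a" "n \<le> k + b" for k
    using less.prems by simp_all
  show ?case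
  proof (rule game.expand, intro conjI fset_eqI)
    fix X
    show "X |\<in>| left_opts (full_support n a b) \<longleftrightarrow> X |\<in>| left_opts (nimber n)"
      unfolding left_opts_full_support opts using IH small by metis
    show "X |\<in>| right_opts (full_support n a b) \<longleftrightarrow> X |\<in>| right_opts (nimber n)"
      unfolding right_opts_full_support opts using IH small by metis
  qed
qed

text \<open>
  Both comparisons are proved together, since each calls on the other for smaller heaps. In the
  first part Right moves the larger heap: to the size of the smaller one if that is within reach,
  and otherwise by the smallest possible step, after which the gap is at least \<open>b > a\<close>.
\<close>

lemma full_support_compare:
  assumes "0 < b" and "a < b"
  shows "(k < m \<longrightarrow> \<not> game_ge (full_support m a b) (full_support k a b)) \<and>
    (k + a < m \<longrightarrow> game_ge (full_support k a b) (full_support m a b))"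
proof (induction "k + m" arbitrary: k m rule: less_induct)
  case less
  have "\<not> game_ge (full_support m a b) (full_support k a b)" if "k < m"
  proof -
    define r where "r = (if m \<le> k + b then k else m - 1)"
    have "full_support r a b |\<in>| right_opts (full_support m a b)"
      unfolding right_opts_full_support using that assms by (intro exI[of _ r]) (auto simp: r_def)
    moreover have "game_ge (full_support k a b) (full_support r a b)"
      using less[of k "m - 1"] that assms by (auto simp: r_def game_ge_refl)
    ultimately show ?thesis
      using game_ge_iff[of "full_support m a b" "full_support k a b"] by blast
  qed
  moreover have "game_ge (full_support k a b) (full_support m a b)" if "k + a < m"
    unfolding game_ge_iff[of "full_support k a b" "full_support m a b"]
      left_opts_full_support right_opts_full_support
    using that less by (auto simp: add.commute)
  ultimately show ?case
    by blast
qed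

lemma full_support_not_ge:
  "a < b \<Longrightarrow> k < m \<Longrightarrow> \<not> game_ge (full_support m a b) (full_support k a b)"
  using full_support_compare[of b a k m] by simp

lemma full_support_confused:
  assumes "a < b" and "k \<noteq> m" and "k \<le> m + a" and "m \<le> k + a"
  shows "\<not> game_ge (full_support k a b) (full_support m a b)"
proof (cases "m < k")
  case True
  then show ?thesis
    using full_support_not_ge assms by blast
next
  case False
  then have "full_support k a b |\<in>| left_opts (full_support m a b)"
    using assms unfolding left_opts_full_support by (intro exI[of _ k]) auto
  then show ?thesis
    by (rule not_left_option_ge)
qed


section \<open>The canonical form of a Full Support heap\<close>

text \<open>
  Let \<open>X\<close> arise from a large heap by replacing the Right options by \<open>0\<close> and the Left options by equal
  games. A Right move from the heap to a smaller one \<open>k\<close> is harmless in the comparison with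
  \<open>X\<close>: Left has a refutation of \<open>X \<ge> G k\<close>. If \<open>k = 0\<close> it is the option \<open>0\<close> of \<open>X\<close>; otherwise
  it is the move to the heap \<open>k - a\<close>, or to \<open>0\<close> if \<open>k \<le> a\<close>, whose size is below that of
  every Left option of \<open>X\<close>, so that this heap is at least \<open>X\<close>.
\<close>

lemma not_ge_smaller_heap:
  assumes "0 < a" and "a < b" and "a < n" and "k < n"
    and right: "zero_game |\<in>| right_opts X"
    and left: "\<And>L. L |\<in>| left_opts X \<Longrightarrow> \<exists>m. m < n \<and> n \<le> m + a \<and> game_eq L (full_support m a b)"
  shows "\<not> game_ge X (full_support k a b)"
  using \<open>k < n\<close>
proof (induction k rule: less_induct)
  case (less k)
  show ?case
  proof (cases "k = 0")
    case True
    then show ?thesis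
      using not_ge_right_option[OF right] by (simp add: full_support_0)
  next
    case False
    have "full_support (k - a) a b |\<in>| left_opts (full_support k a b)"
      unfolding left_opts_full_support using False \<open>0 < a\<close> by (intro exI[of _ "k - a"]) auto
    moreover have "game_ge (full_support (k - a) a b) X"
    proof (subst game_ge_iff, intro conjI allI impI)
      fix R assume "R |\<in>| right_opts (full_support (k - a) a b)"
      then show "\<not> game_ge X R"
        using less by (auto simp: right_opts_full_support)
    next
      fix L assume "L |\<in>| left_opts X"
      then obtain m where m: "n \<le> m + a" "game_eq L (full_support m a b)"
        using left by blast
      then have "k - a < m"
        using less.prems \<open>a < n\<close> by linarith
      then show "\<not> game_ge L (full_support (k - a) a b)"
        using full_support_not_ge[OF \<open>a < b\<close>] game_ge_cong[OF m(2) game_eq_refl] by blast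
    qed
    ultimately show ?thesis
      using game_ge_iff[of X "full_support k a b"] by blast
  qed
qed

text \<open>
  The Left options on both sides agree in value, so only the Right options can tell the two games
  apart. Moving to \<open>0\<close> does not win for Right against the heap, because the heap is not \<open>\<ge> 0\<close>;
  moving to a smaller heap does not win against \<open>X\<close>, by the previous lemma.
\<close>

lemma large_heap_eq:
  assumes "0 < a" and "a < b" and "a < n"
    and K: "\<And>m. m < n \<Longrightarrow> game_eq (K m) (full_support m a b)"
    and right: "\<And>R. R |\<in>| right_opts X \<longleftrightarrow> R = zero_game"
    and left: "\<And>L. L |\<in>| left_opts X \<longleftrightarrow> (\<exists>m. m < n \<and> n \<le> m + a \<and> L = K m)"
  shows "game_eq X (full_support n a b)"
  unfolding game_eq_iff
proof
  let ?G = "full_support n a b"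
  show "game_ge X ?G"
  proof (subst game_ge_iff, intro conjI allI impI)
    fix R assume "R |\<in>| right_opts X"
    then show "\<not> game_ge ?G R"
      using full_support_not_ge[of a b 0 n] assms(2,3) by (simp add: right full_support_0)
  next
    fix L assume "L |\<in>| left_opts ?G"
    then obtain m where m: "m < n" "n \<le> m + a" "L = full_support m a b"
      by (auto simp: left_opts_full_support)
    then have "\<not> game_ge (K m) X"
      using left not_left_option_ge by blast
    then show "\<not> game_ge L X"
      using game_ge_cong[OF K[OF m(1)] game_eq_refl] m by blast
  qed
  show "game_ge ?G X"
  proof (subst game_ge_iff, intro conjI allI impI)
    fix R assume "R |\<in>| right_opts ?G"
    then show "\<not> game_ge X R"
      using not_ge_smaller_heap[OF assms(1-3), of _ X] K right left
      by (auto simp: right_opts_full_support)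
  next
    fix L assume "L |\<in>| left_opts X"
    then obtain m where m: "m < n" "n \<le> m + a" "L = K m"
      by (auto simp: left)
    then have "\<not> game_ge (full_support m a b) ?G"
      by (intro not_left_option_ge) (auto simp: left_opts_full_support)
    then show "\<not> game_ge L ?G"
      using game_ge_cong[OF K[OF m(1)] game_eq_refl] m by blast
  qed
qed

text \<open>
  The only facts about the Left options that canonicity needs are that they are canonical forms of
  the heaps from which they come and that Right can move from them only to forms that are
  themselves heaps.
\<close>

lemma left_options_neither_dominated_nor_reversible:
  assumes "a < b" and X: "game_eq X (full_support n a b)"
    and left: "\<And>L. L |\<in>| left_opts X \<Longrightarrow>
      \<exists>m. m < n \<and> n \<le> m + a \<and> L = K m \<and> game_eq (K m) (full_support m a b) \<and>
        (\<forall>R. R |\<in>| right_opts (K m) \<longrightarrow> (\<exists>k<m. R = full_support k a b))"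
  shows "\<not> left_dominated X L" and "\<not> left_reversible X L"
proof -
  show "\<not> left_dominated X L"
  proof
    assume "left_dominated X L"
    then obtain L' where *: "L |\<in>| left_opts X" "L' |\<in>| left_opts X" "L' \<noteq> L" "game_ge L' L"
      unfolding left_dominated_def by blast
    obtain m where m: "m < n" "n \<le> m + a" "L = K m" "game_eq (K m) (full_support m a b)"
      using left[OF *(1)] by blast
    obtain m' where m': "m' < n" "n \<le> m' + a" "L' = K m'" "game_eq (K m') (full_support m' a b)"
      using left[OF *(2)] by blast
    have "m \<noteq> m'"
      using m(3) m'(3) *(3) by blast
    then have "\<not> game_ge (full_support m' a b) (full_support m a b)"
      using m(1,2) m'(1,2) assms(1) by (intro full_support_confused) auto
    then show False
      using game_ge_cong[OF m'(4) m(4)] *(4) m(3) m'(3) by blast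
  qed
  show "\<not> left_reversible X L"
  proof
    assume "left_reversible X L"
    then obtain R where R: "L |\<in>| left_opts X" "R |\<in>| right_opts L" "game_ge X R"
      unfolding left_reversible_def by blast
    then obtain k where "k < n" "R = full_support k a b"
      using left[OF R(1)] by (metis less_trans)
    then show False
      using full_support_not_ge[OF assms(1)] game_ge_cong[OF X game_eq_refl] R(3) by blast
  qed
qed

text \<open>
  From a small heap both players reach exactly the smaller heaps, any two of which are confused.
  This excludes domination, and also reversal, which would compare the heap with a smaller one.
\<close>

lemma canonical_small_heap:
  assumes "a < b" and "n \<le> a"
  shows "canonical (full_support n a b)"
  using \<open>n \<le> a\<close>
proof (induction n rule: less_induct)
  case (less n)
  let ?G = "\<lambda>k. full_support k a b"
  have left: "L |\<in>| left_opts (?G m) \<longleftrightarrow> (\<exists>k<m. L = ?G k)"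
    and right: "L |\<in>| right_opts (?G m) \<longleftrightarrow> (\<exists>k<m. L = ?G k)" if "m \<le> n" for L m
    using that less.prems assms(1) by (auto simp: left_opts_full_support right_opts_full_support)
  have confused: "\<not> game_ge (?G k) (?G m)" if "k \<noteq> m" "k \<le> n" "m \<le> n" for k m
    using that less.prems by (intro full_support_confused assms(1)) auto
  show ?case
  proof (rule canonicalI)
    fix X
    show "\<not> left_dominated (?G n) X" "\<not> right_dominated (?G n) X"
      unfolding left_dominated_def right_dominated_def left[OF order_refl] right[OF order_refl]
      using confused by (metis less_imp_le)+
    show "\<not> left_reversible (?G n) X" "\<not> right_reversible (?G n) X"
      unfolding left_reversible_def right_reversible_def left[OF order_refl] right[OF order_refl]
      using confused left right by (metis less_imp_le less_irrefl less_trans order_refl)+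
  qed (use less left right in auto)
qed

definition full_support_form :: "nat \<Rightarrow> nat \<Rightarrow> nat \<Rightarrow> game" where
  "full_support_form n a b =
     Game ((\<lambda>i. canonical_form (full_support (n - i) a b)) |`| fset_of_list [1..<Suc a])
          {|zero_game|}"

lemma left_opts_full_support_form:
  assumes "a < n"
  shows "L |\<in>| left_opts (full_support_form n a b) \<longleftrightarrow>
    (\<exists>m. m < n \<and> n \<le> m + a \<and> L = canonical_form (full_support m a b))"
  using assms fimage_remove_iff[of L "\<lambda>k. canonical_form (full_support k a b)" n a]
  unfolding full_support_form_def game.sel by (simp only: min_absorb1 less_imp_le)

text \<open>
  The statement about the Right options is carried through the induction because whether a
  Left option of the form is reversible depends on the Right options of the canonical forms of smaller heaps.
\<close>

lemma canonical_form_full_support: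
  assumes "0 < a" and "a < b"
  shows "is_canonical_form_of (canonical_form (full_support n a b)) (full_support n a b) \<and>
    (\<forall>R. R |\<in>| right_opts (canonical_form (full_support n a b)) \<longrightarrow>
       (\<exists>k<n. R = full_support k a b)) \<and>
    (a < n \<longrightarrow> canonical_form (full_support n a b) = full_support_form n a b)"
proof (induction n rule: less_induct)
  case (less n)
  let ?G = "\<lambda>k. full_support k a b"
  show ?case
  proof (cases "n \<le> a")
    case True
    then have "is_canonical_form_of (?G n) (?G n)"
      using assms by (simp add: is_canonical_form_of_def game_eq_refl canonical_small_heap)
    then show ?thesis
      using True canonical_form_eqI by (auto simp: right_opts_full_support)
  next
    case False
    then have "a < n"
      by simp
    let ?X = "full_support_form n a b"
    have right: "R |\<in>| right_opts ?X \<longleftrightarrow> R = zero_game" for R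
      by (simp add: full_support_form_def)
    have left: "L |\<in>| left_opts ?X \<longleftrightarrow>
        (\<exists>m. m < n \<and> n \<le> m + a \<and> L = canonical_form (?G m))" for L
      by (rule left_opts_full_support_form[OF \<open>a < n\<close>])
    have K: "game_eq (canonical_form (?G m)) (?G m)" "canonical (canonical_form (?G m))"
      if "m < n" for m
      using less that unfolding is_canonical_form_of_def by blast+
    have eq: "game_eq ?X (?G n)"
      using large_heap_eq[OF assms \<open>a < n\<close> K(1) right left] .
    have "\<exists>m. m < n \<and> n \<le> m + a \<and> L = canonical_form (?G m) \<and>
        game_eq (canonical_form (?G m)) (?G m) \<and>
        (\<forall>R. R |\<in>| right_opts (canonical_form (?G m)) \<longrightarrow> (\<exists>k<m. R = ?G k))"
      if L: "L |\<in>| left_opts ?X" for L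
    proof -
      obtain m where m: "m < n" "n \<le> m + a" "L = canonical_form (?G m)"
        using L unfolding left by blast
      then show ?thesis
        using K(1)[OF m(1)] less[OF m(1)] by (intro exI[of _ m]) simp
    qed
    note good = left_options_neither_dominated_nor_reversible[OF assms(2) eq this]
    have "canonical ?X"
    proof (rule canonicalI)
      fix Y
      show "\<not> left_dominated ?X Y" "\<not> left_reversible ?X Y"
        by (rule good; assumption)+
      show "\<not> right_dominated ?X Y" "\<not> right_reversible ?X Y"
        unfolding right_dominated_def right_reversible_def right
        by (auto simp: zero_game_def)
    next
      fix R assume "R |\<in>| right_opts ?X"
      then show "canonical R"
        using canonical_small_heap[OF assms(2), of 0] by (simp add: right full_support_0)
    next
      fix L assume "L |\<in>| left_opts ?X"
      then show "canonical L"
        unfolding left using K(2) by blast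
    qed
    with eq have "is_canonical_form_of ?X (?G n)"
      by (simp add: is_canonical_form_of_def)
    moreover have "\<exists>k<n. R = ?G k" if "R |\<in>| right_opts ?X" for R
      using that \<open>a < n\<close> by (auto simp: right full_support_0 intro!: exI[of _ 0])
    ultimately show ?thesis
      using canonical_form_eqI by metis
  qed
qed

lemma inj_canonical_form_full_support:
  assumes "0 < a" and "a < b"
  shows "inj (\<lambda>n. canonical_form (full_support n a b))"
proof (rule linorder_injI)
  fix k m :: nat
  assume "k < m"
  have eq: "game_eq (canonical_form (full_support n a b)) (full_support n a b)" for n
    using canonical_form_full_support[OF assms] is_canonical_form_of_def by blast
  have "\<not> game_ge (canonical_form (full_support m a b)) (canonical_form (full_support k a b))"
    using full_support_not_ge[OF assms(2) \<open>k < m\<close>] game_ge_cong[OF eq eq] by blast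
  then show "canonical_form (full_support k a b) \<noteq> canonical_form (full_support m a b)"
    using game_ge_refl by metis
qed

theorem theorem1:
  fixes a b n :: nat and G :: game
  assumes "0 < a" and "0 < b" and "a < b"
    and "G = full_support n a b"
  shows "(n \<le> a \<longrightarrow> game_eq G (nimber n)) \<and>
    (n > a \<longrightarrow>
      (let X = Game ((\<lambda>i. canonical_form (full_support (n - i) a b)) |`| fset_of_list [1..<Suc a])
                    {|zero_game|}
       in is_canonical_form_of X G \<and> canonical_form G = X \<and>
          inj_on (\<lambda>i. canonical_form (full_support (n - i) a b)) {1..a}))"
proof -
  have "game_eq G (nimber n)" if "n \<le> a"
    using that assms by (simp add: full_support_eq_nimber game_eq_refl)
  moreover have "inj_on (\<lambda>i. canonical_form (full_support (n - i) a b)) {1..a}" if "a < n"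
    using that injD[OF inj_canonical_form_full_support[OF assms(1,3)]]
    by (fastforce intro!: inj_onI)
  moreover have "is_canonical_form_of (full_support_form n a b) G"
    and "canonical_form G = full_support_form n a b" if "a < n"
    using canonical_form_full_support[OF assms(1,3), of n] that assms(4) by auto
  ultimately show ?thesis
    unfolding Let_def full_support_form_def[symmetric] by blast
qed

end
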